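(* Let $L$ be a finite lattice. Then there exist a finite, atomistic, biatomic lattice $M$ and a $\langle\vee,\wedge,0,1,\mathsf{at}\rangle$-embedding from $L$ into $M$, that is, an injective map $e\colon L\to M$ that preserves binary joins, binary meets, the least element and the greatest element, and that sends every atom of $L$ to an atom of $M$.
   Context: Let $L$ be a lattice with a least element $0$. An atom of $L$ is a minimal element of $L\setminus\{0\}$. The lattice $L$ is atomic if every nonzero element of $L$ lies above some atom. It is atomistic if every element of $L$ is a join of atoms ($0$ being the empty join). It is biatomic if it is atomic and, for every atom $p$ of $L$ and all nonzero $a,b\in L$ with $p\le a\vee b$, there are atoms $x\le a$ and $y\le b$ of $L$ such that $p\le x\vee y$. *)

theory Defs
  imports "HOL-Algebra.Lattice"
begin

text \<open>The locale \<^locale>\<open>partial_order\<close> identifies the equality \<^term>\<open>eq L\<close> of the order with HOL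
  equality, so \<open>=\<close> and \<open>\<noteq>\<close> are used below.\<close>

locale lattice_with_zero = lattice + weak_partial_order_bottom

text \<open>Meaningful only if \<open>L\<close> has a least element; otherwise \<open>\<bottom>\<^bsub>L\<^esub>\<close> is unspecified.\<close>

definition atom :: "('a, 'b) gorder_scheme \<Rightarrow> 'a \<Rightarrow> bool" where
  "atom L p \<longleftrightarrow> p \<in> carrier L - {\<bottom>\<^bsub>L\<^esub>} \<and>
     (\<forall>x \<in> carrier L - {\<bottom>\<^bsub>L\<^esub>}. x \<sqsubseteq>\<^bsub>L\<^esub> p \<longrightarrow> x = p)"

locale atomic_lattice = lattice_with_zero +
  assumes above_atom:
    "\<lbrakk> x \<in> carrier L; x \<noteq> \<bottom> \<rbrakk> \<Longrightarrow> \<exists>p. atom L p \<and> p \<sqsubseteq> x"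

text \<open>In the next locale \<open>A\<close> may be infinite, or empty: \<^term>\<open>is_lub L x {}\<close> says that \<open>x\<close> is least.\<close>

locale atomistic_lattice = lattice_with_zero +
  assumes join_of_atoms:
    "x \<in> carrier L \<Longrightarrow> \<exists>A. A \<subseteq> {p. atom L p} \<and> is_lub L x A"

locale biatomic_lattice = atomic_lattice +
  assumes atom_below_join:
    "\<lbrakk> atom L p; a \<in> carrier L; b \<in> carrier L; a \<noteq> \<bottom>; b \<noteq> \<bottom>; p \<sqsubseteq> a \<squnion> b \<rbrakk> \<Longrightarrow>
     \<exists>x y. atom L x \<and> atom L y \<and> x \<sqsubseteq> a \<and> y \<sqsubseteq> b \<and> p \<sqsubseteq> x \<squnion> y"

definition bounded_atom_embedding ::
    "('a, 'c) gorder_scheme \<Rightarrow> ('b, 'd) gorder_scheme \<Rightarrow> ('a \<Rightarrow> 'b) \<Rightarrow> bool" where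
  "bounded_atom_embedding L M e \<longleftrightarrow>
     e \<in> carrier L \<rightarrow> carrier M \<and> inj_on e (carrier L) \<and>
     join_pres L M e \<and> meet_pres L M e \<and>
     e \<bottom>\<^bsub>L\<^esub> = \<bottom>\<^bsub>M\<^esub> \<and> e \<top>\<^bsub>L\<^esub> = \<top>\<^bsub>M\<^esub> \<and>
     (\<forall>p. atom L p \<longrightarrow> atom M (e p))"

end

theory Submission
  imports Defs
begin

text \<open>
  Let \<open>P\<close> be the set of nonzero elements of \<open>L\<close>, and for \<open>a \<in> L\<close> let
  \<open>I a = {x \<in> P. x \<le> a}\<close>.  Take for \<open>M\<close> the family of all sets \<open>I a\<close> and all singletons \<open>{a}\<close>
  with \<open>a \<in> P\<close>, ordered by inclusion.  This family contains the empty set \<open>I 0\<close> and the whole of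
  \<open>P = I 1\<close>, and it is closed under intersection, so it is a finite lattice whose atoms are the
  singletons; each of its members is the union, hence the join, of the singletons inside it.

  The map \<open>I\<close> is the embedding.  Meets are intersections.  For incomparable \<open>a\<close>, \<open>b\<close> no singleton
  contains both points, and a set \<open>I c\<close> that contains both of them contains \<open>I (a \<squnion> b)\<close>; so this is
  the join of \<open>I a\<close> and \<open>I b\<close> (lemma \<open>hull_I_Un_I\<close>).  For comparable \<open>a\<close>, \<open>b\<close> it is the
  larger of the two sets.  If \<open>a\<close> is an atom, then \<open>I a = {a}\<close>.

  For biatomicity, every nonempty member \<open>X\<close> has a greatest element \<open>a\<close>, and \<open>X\<close> is \<open>{a}\<close> or \<open>I a\<close>.
  Let \<open>a\<close>, \<open>b\<close> be the greatest elements of \<open>X\<close>, \<open>Y\<close>.  If \<open>a \<noteq> b\<close>, then each member that contains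
  both \<open>a\<close> and \<open>b\<close> is of the form \<open>I c\<close>, hence contains \<open>X\<close> and \<open>Y\<close>; so the two atoms \<open>{a}\<close> and
  \<open>{b}\<close> already have the same join as \<open>X\<close> and \<open>Y\<close>.  If \<open>a = b\<close>, then \<open>X\<close> and \<open>Y\<close> are comparable, a
  point of their join lies in one of them, and it serves as its own witness
  (lemma \<open>point_of_hull_Un\<close>).
\<close>

section \<open>Atomistic lattices from families of sets closed under intersection\<close>

text \<open>The members of \<open>\<C>\<close> are named through \<open>code\<close>, so that the lattice can live on a type other than
  that of sets of points; here it will be the type of natural numbers.\<close>

definition coded_inclusion :: "('p set \<Rightarrow> 'm) \<Rightarrow> 'p set set \<Rightarrow> 'm gorder" where
  "coded_inclusion code \<C> =
     \<lparr>carrier = code ` \<C>, eq = (=), le = (\<lambda>u v. inv_into \<C> code u \<subseteq> inv_into \<C> code v)\<rparr>"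

definition hull :: "'p set set \<Rightarrow> 'p set \<Rightarrow> 'p set" where
  "hull \<C> A = \<Inter>{Y \<in> \<C>. A \<subseteq> Y}"

lemma subset_hull: "A \<subseteq> hull \<C> A"
  by (auto simp: hull_def)

lemma hull_minimal: "Y \<in> \<C> \<Longrightarrow> A \<subseteq> Y \<Longrightarrow> hull \<C> A \<subseteq> Y"
  by (auto simp: hull_def)

lemma hull_eqI:
  assumes "Z \<in> \<C>" "A \<subseteq> Z" "\<And>Y. Y \<in> \<C> \<Longrightarrow> A \<subseteq> Y \<Longrightarrow> Z \<subseteq> Y"
  shows "hull \<C> A = Z"
  using assms by (auto simp: hull_def)

locale singleton_closure_family =
  fixes \<C> :: "'p set set" and code :: "'p set \<Rightarrow> 'm"
  assumes finite_family: "finite \<C>"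
    and inj_code: "inj_on code \<C>"
    and empty_mem: "{} \<in> \<C>"
    and Union_mem: "\<Union>\<C> \<in> \<C>"
    and Int_mem: "X \<in> \<C> \<Longrightarrow> Y \<in> \<C> \<Longrightarrow> X \<inter> Y \<in> \<C>"
    and singleton_mem: "x \<in> \<Union>\<C> \<Longrightarrow> {x} \<in> \<C>"
begin

definition M :: "'m gorder" where "M = coded_inclusion code \<C>"

lemma carrier_M: "carrier M = code ` \<C>"
  by (simp add: M_def coded_inclusion_def)

lemma eq_M: "eq M = (=)"
  by (simp add: M_def coded_inclusion_def)

lemma code_mem [simp]: "X \<in> \<C> \<Longrightarrow> code X \<in> carrier M"
  by (simp add: carrier_M)

lemma le_M [simp]: "X \<in> \<C> \<Longrightarrow> Y \<in> \<C> \<Longrightarrow> code X \<sqsubseteq>\<^bsub>M\<^esub> code Y \<longleftrightarrow> X \<subseteq> Y"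
  by (simp add: M_def coded_inclusion_def inv_into_f_f[OF inj_code])

lemma code_eq_iff [simp]: "X \<in> \<C> \<Longrightarrow> Y \<in> \<C> \<Longrightarrow> code X = code Y \<longleftrightarrow> X = Y"
  using inj_code by (auto simp: inj_on_eq_iff)

text \<open>A finite nonempty family of members has its intersection in \<open>\<C>\<close>; the family here is nonempty
  because \<open>\<Union>\<C>\<close> is one of the members above \<open>A\<close>.\<close>

lemma hull_mem:
  assumes "A \<subseteq> \<Union>\<C>"
  shows "hull \<C> A \<in> \<C>"
proof -
  have "\<Inter>\<F> \<in> \<C>" if "finite \<F>" "\<F> \<noteq> {}" "\<F> \<subseteq> \<C>" for \<F>
    using that by (induction \<F> rule: finite_ne_induct) (auto intro: Int_mem)
  moreover have "finite {Y \<in> \<C>. A \<subseteq> Y}" using finite_family by simp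
  ultimately show ?thesis
    unfolding hull_def using Union_mem assms by blast
qed

lemma hull_Un_mem: "X \<in> \<C> \<Longrightarrow> Y \<in> \<C> \<Longrightarrow> hull \<C> (X \<union> Y) \<in> \<C>"
  by (rule hull_mem) blast

lemma partial_order_M: "partial_order M"
  by unfold_locales (auto simp: carrier_M eq_M)

text \<open>Stated for arbitrary subfamilies so that it gives both the binary joins and, applied to
  singletons, atomisticity.\<close>

lemma is_lub_code:
  assumes "\<X> \<subseteq> \<C>" "Z \<in> \<C>" "\<Union>\<X> \<subseteq> Z" "\<And>Y. Y \<in> \<C> \<Longrightarrow> \<Union>\<X> \<subseteq> Y \<Longrightarrow> Z \<subseteq> Y"
  shows "is_lub M (code Z) (code ` \<X>)"
proof (rule least_UpperI)
  fix u assume u: "u \<in> Upper M (code ` \<X>)"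
  then obtain Y where Y: "u = code Y" "Y \<in> \<C>"
    by (auto simp: Upper_def carrier_M)
  have "X \<subseteq> Y" if "X \<in> \<X>" for X
  proof -
    have "X \<in> \<C>" using that assms(1) by blast
    moreover from this have "code X \<sqsubseteq>\<^bsub>M\<^esub> u" using u that by (simp add: Upper_def)
    ultimately show ?thesis using Y by simp
  qed
  then have "Z \<subseteq> Y" using assms(4) Y by blast
  then show "code Z \<sqsubseteq>\<^bsub>M\<^esub> u" using Y assms(2) by simp
next
  fix u assume "u \<in> code ` \<X>"
  then obtain X where "X \<in> \<X>" "u = code X" by blast
  moreover from this have "X \<in> \<C>" "X \<subseteq> Z" using assms(1,3) by blast+
  ultimately show "u \<sqsubseteq>\<^bsub>M\<^esub> code Z" using assms(2) by simp
qed (use assms(1,2) in \<open>auto simp: carrier_M\<close>)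

lemma is_lub_hull:
  assumes "X \<in> \<C>" "Y \<in> \<C>"
  shows "is_lub M (code (hull \<C> (X \<union> Y))) {code X, code Y}"
  using is_lub_code[of "{X, Y}" "hull \<C> (X \<union> Y)"] assms
    hull_Un_mem subset_hull[of "X \<union> Y" \<C>] by (simp add: hull_minimal)

lemma is_glb_Int:
  assumes "X \<in> \<C>" "Y \<in> \<C>"
  shows "is_glb M (code (X \<inter> Y)) {code X, code Y}"
  by (rule greatest_LowerI) (use assms Int_mem in \<open>auto simp: Lower_def carrier_M\<close>)

lemma lattice_M: "lattice M"
proof -
  interpret partial_order M by (rule partial_order_M)
  show ?thesis
    by unfold_locales (auto simp: carrier_M intro: is_lub_hull is_glb_Int)
qed

sublocale lattice M by (rule lattice_M)

lemma join_code: "X \<in> \<C> \<Longrightarrow> Y \<in> \<C> \<Longrightarrow> code X \<squnion>\<^bsub>M\<^esub> code Y = code (hull \<C> (X \<union> Y))"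
  by (meson is_lub_hull least_unique code_mem sup_of_two_least[folded join_def])

lemma meet_code: "X \<in> \<C> \<Longrightarrow> Y \<in> \<C> \<Longrightarrow> code X \<sqinter>\<^bsub>M\<^esub> code Y = code (X \<inter> Y)"
  by (meson is_glb_Int greatest_unique code_mem inf_of_two_greatest[folded meet_def])

lemma least_code_empty: "least M (code {}) (carrier M)"
  by (auto simp: least_def carrier_M empty_mem)

lemma greatest_code_Union: "greatest M (code (\<Union>\<C>)) (carrier M)"
  by (auto simp: greatest_def carrier_M Union_mem)

sublocale lattice_with_zero M
  by unfold_locales (use least_code_empty in blast)

lemma bottom_M: "\<bottom>\<^bsub>M\<^esub> = code {}"
  by (rule least_unique[OF bottom_least least_code_empty])

lemma top_M: "\<top>\<^bsub>M\<^esub> = code (\<Union>\<C>)"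
  unfolding top_def using greatest_code_Union greatest_unique by (intro some_equality)

lemma atom_M_iff: "atom M u \<longleftrightarrow> (\<exists>x \<in> \<Union>\<C>. u = code {x})"
proof
  assume u: "atom M u"
  then obtain X where X: "X \<in> \<C>" "u = code X" "X \<noteq> {}"
    by (auto simp: atom_def carrier_M bottom_M)
  then obtain x where x: "x \<in> X" by blast
  have "{x} \<in> \<C>" using X x by (blast intro: singleton_mem)
  then have "code {x} \<in> carrier M - {\<bottom>\<^bsub>M\<^esub>}" "code {x} \<sqsubseteq>\<^bsub>M\<^esub> u"
    using X x by (simp_all add: bottom_M empty_mem)
  then have "u = code {x}" using u unfolding atom_def by metis
  moreover have "x \<in> \<Union>\<C>" using X(1) x by (rule UnionI)
  ultimately show "\<exists>x \<in> \<Union>\<C>. u = code {x}" by (rule bexI)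
next
  assume "\<exists>x \<in> \<Union>\<C>. u = code {x}"
  then obtain x where "{x} \<in> \<C>" "u = code {x}" using singleton_mem by blast
  then show "atom M u"
    by (auto simp: atom_def carrier_M bottom_M empty_mem)
qed

lemma atomistic_M: "atomistic_lattice M"
proof unfold_locales
  fix u assume "u \<in> carrier M"
  then obtain X where X: "X \<in> \<C>" "u = code X" by (auto simp: carrier_M)
  let ?\<X> = "(\<lambda>x. {x}) ` X"
  have "is_lub M u (code ` ?\<X>)"
    unfolding X(2) by (rule is_lub_code) (use X in \<open>auto intro: singleton_mem\<close>)
  moreover have "code ` ?\<X> \<subseteq> {p. atom M p}"
    using X by (auto simp: atom_M_iff)
  ultimately show "\<exists>A. A \<subseteq> {p. atom M p} \<and> is_lub M u A" by blast
qed

text \<open>Since the atoms are the singletons of points, biatomicity becomes a condition on points and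
  hulls, which no longer mentions the coding.\<close>

lemma biatomic_M:
  assumes "\<And>X Y p. \<lbrakk>X \<in> \<C>; Y \<in> \<C>; X \<noteq> {}; Y \<noteq> {}; p \<in> hull \<C> (X \<union> Y)\<rbrakk>
    \<Longrightarrow> \<exists>x \<in> X. \<exists>y \<in> Y. p \<in> hull \<C> {x, y}"
  shows "biatomic_lattice M"
proof unfold_locales
  fix u assume "u \<in> carrier M" "u \<noteq> \<bottom>\<^bsub>M\<^esub>"
  then obtain X where "X \<in> \<C>" "u = code X" "X \<noteq> {}"
    by (auto simp: carrier_M bottom_M)
  moreover from this obtain x where "x \<in> X" by blast
  moreover from calculation have "{x} \<in> \<C>" by (blast intro: singleton_mem)
  ultimately have "atom M (code {x}) \<and> code {x} \<sqsubseteq>\<^bsub>M\<^esub> u"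
    by (auto simp: atom_M_iff)
  then show "\<exists>p. atom M p \<and> p \<sqsubseteq>\<^bsub>M\<^esub> u" ..
next
  fix p a b
  assume "atom M p" "a \<in> carrier M" "b \<in> carrier M" "a \<noteq> \<bottom>\<^bsub>M\<^esub>" "b \<noteq> \<bottom>\<^bsub>M\<^esub>"
    and le: "p \<sqsubseteq>\<^bsub>M\<^esub> a \<squnion>\<^bsub>M\<^esub> b"
  then obtain q X Y where q: "q \<in> \<Union>\<C>" "p = code {q}"
    and XY: "X \<in> \<C>" "a = code X" "X \<noteq> {}" "Y \<in> \<C>" "b = code Y" "Y \<noteq> {}"
    by (auto simp: atom_M_iff carrier_M bottom_M)
  have "q \<in> hull \<C> (X \<union> Y)"
    using le q XY by (simp add: join_code hull_Un_mem singleton_mem)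
  with assms XY obtain x y where xy: "x \<in> X" "y \<in> Y" "q \<in> hull \<C> {x, y}" by blast
  have mem: "{x} \<in> \<C>" "{y} \<in> \<C>" using xy XY by (blast intro: singleton_mem)+
  moreover have "hull \<C> ({x} \<union> {y}) \<in> \<C>" using mem by (rule hull_Un_mem)
  ultimately have "code {x} \<sqsubseteq>\<^bsub>M\<^esub> a" "code {y} \<sqsubseteq>\<^bsub>M\<^esub> b" "p \<sqsubseteq>\<^bsub>M\<^esub> code {x} \<squnion>\<^bsub>M\<^esub> code {y}"
    using q xy XY by (simp_all add: join_code singleton_mem insert_commute)
  moreover have "atom M (code {x})" "atom M (code {y})"
    using mem by (auto simp: atom_M_iff)
  ultimately show "\<exists>x y. atom M x \<and> atom M y \<and> x \<sqsubseteq>\<^bsub>M\<^esub> a \<and> y \<sqsubseteq>\<^bsub>M\<^esub> b \<and> p \<sqsubseteq>\<^bsub>M\<^esub> x \<squnion>\<^bsub>M\<^esub> y"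
    by blast
qed

end

section \<open>Punctured principal ideals and singletons of a finite lattice\<close>

locale finite_nonempty_lattice = lattice L for L (structure) +
  assumes finite_carrier: "finite (carrier L)"
    and nonempty_carrier: "carrier L \<noteq> {}"
begin

lemma least_inf: "least L (\<Sqinter>(carrier L)) (carrier L)"
  using finite_inf_greatest[OF finite_carrier subset_refl nonempty_carrier]
  by (auto simp: least_def greatest_def Lower_def)

lemma greatest_sup: "greatest L (\<Squnion>(carrier L)) (carrier L)"
  using finite_sup_least[OF finite_carrier subset_refl nonempty_carrier]
  by (auto simp: least_def greatest_def Upper_def)

sublocale bounded_lattice L
  by unfold_locales (use least_inf greatest_sup in blast)+

definition I :: "'a \<Rightarrow> 'a set" where
  "I a = {x \<in> carrier L - {\<bottom>}. x \<sqsubseteq> a}"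

definition \<C> :: "'a set set" where
  "\<C> = I ` carrier L \<union> (\<lambda>a. {a}) ` (carrier L - {\<bottom>})"

lemma I_mem: "a \<in> carrier L \<Longrightarrow> I a \<in> \<C>"
  by (simp add: \<C>_def)

lemma singleton_mem_\<C>: "a \<in> carrier L \<Longrightarrow> a \<noteq> \<bottom> \<Longrightarrow> {a} \<in> \<C>"
  by (simp add: \<C>_def)

lemma I_mono: "a \<sqsubseteq> b \<Longrightarrow> a \<in> carrier L \<Longrightarrow> b \<in> carrier L \<Longrightarrow> I a \<subseteq> I b"
  by (auto simp: I_def intro: le_trans)

lemma I_bottom: "I \<bottom> = {}"
  by (auto simp: I_def)

lemma I_top: "I \<top> = carrier L - {\<bottom>}"
  by (auto simp: I_def)

lemma I_subset_iff:
  assumes "a \<in> carrier L" "b \<in> carrier L"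
  shows "I a \<subseteq> I b \<longleftrightarrow> a \<sqsubseteq> b"
proof
  assume "I a \<subseteq> I b"
  with assms show "a \<sqsubseteq> b" by (cases "a = \<bottom>") (auto simp: I_def)
qed (use assms I_mono in blast)

lemma I_meet:
  assumes "a \<in> carrier L" "b \<in> carrier L"
  shows "I (a \<sqinter> b) = I a \<inter> I b"
  using assms meet_left[of a b] meet_right[of a b] meet_le[of _ a b]
  by (auto simp: I_def intro: le_trans[OF _ meet_left] le_trans[OF _ meet_right])

lemma Union_\<C>: "\<Union>\<C> = carrier L - {\<bottom>}"
  by (auto simp: \<C>_def I_def)

lemma Int_mem_\<C>:
  assumes "X \<in> \<C>" "Y \<in> \<C>"
  shows "X \<inter> Y \<in> \<C>"
proof -
  \<comment> \<open>The empty intersection is a member as the ideal of \<open>\<bottom>\<close>.\<close>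
  have small: "A \<inter> {a} \<in> \<C>" if "a \<in> carrier L - {\<bottom>}" for A a
    using that I_bottom I_mem[OF bottom_closed] singleton_mem_\<C>[of a] by (cases "a \<in> A") auto
  consider (ideals) a b where "a \<in> carrier L" "b \<in> carrier L" "X = I a" "Y = I b"
    | (left) a where "a \<in> carrier L - {\<bottom>}" "X = {a}"
    | (right) b where "b \<in> carrier L - {\<bottom>}" "Y = {b}"
    using assms unfolding \<C>_def by blast
  then show ?thesis
  proof cases
    case ideals
    then show ?thesis using I_mem[of "a \<sqinter> b"] by (simp add: I_meet)
  next
    case left
    then show ?thesis using small[of a Y] by (simp only: Int_commute)
  next
    case right
    then show ?thesis using small[of b X] by simp
  qed
qed

lemma singleton_closure_family_\<C>:
  assumes "inj_on code \<C>"
  shows "singleton_closure_family \<C> code"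
proof
  show "finite \<C>" by (simp add: \<C>_def finite_carrier)
  show "{} \<in> \<C>" using I_mem[OF bottom_closed] by (simp add: I_bottom)
  show "\<Union>\<C> \<in> \<C>" using I_mem[OF top_closed] by (simp add: I_top Union_\<C>)
qed (use assms in \<open>auto simp: Union_\<C> intro: Int_mem_\<C> singleton_mem_\<C>\<close>)

text \<open>In both cases the point \<open>a\<close> is the greatest element of \<open>X\<close>.\<close>

lemma mem_\<C>_cases:
  assumes "X \<in> \<C>" "X \<noteq> {}"
  obtains a where "a \<in> carrier L - {\<bottom>}" "a \<in> X" "X = {a} \<or> X = I a"
  using assms I_bottom by (auto simp: \<C>_def I_def)

text \<open>A member with two different points is not a singleton, so it is a down-set of nonzero elements.\<close>

lemma I_subset_mem_\<C>:
  assumes "Z \<in> \<C>" "a \<in> Z" "b \<in> Z" "a \<noteq> b"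
  shows "I a \<subseteq> Z" "I b \<subseteq> Z"
  using assms by (auto simp: \<C>_def I_def intro: le_trans)

text \<open>A singleton cannot contain \<open>I a \<union> I b\<close> when \<open>a\<close> and \<open>b\<close> are incomparable, as both are then
  points of this union; the ideals that contain it have a generator above \<open>a\<close> and \<open>b\<close>.  For comparable
  \<open>a\<close>, \<open>b\<close> the set \<open>I (a \<squnion> b)\<close> is the larger one of \<open>I a\<close>, \<open>I b\<close>.\<close>

lemma hull_I_Un_I:
  assumes "a \<in> carrier L" "b \<in> carrier L"
  shows "hull \<C> (I a \<union> I b) = I (a \<squnion> b)"
proof (rule hull_eqI)
  show "I (a \<squnion> b) \<in> \<C>" using assms by (simp add: I_mem)
  show "I a \<union> I b \<subseteq> I (a \<squnion> b)"
    using assms by (simp add: I_mono join_left join_right)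
  fix Y assume Y: "Y \<in> \<C>" "I a \<union> I b \<subseteq> Y"
  consider (le) "a \<sqsubseteq> b" | (ge) "b \<sqsubseteq> a" | (incomparable) "\<not> a \<sqsubseteq> b" "\<not> b \<sqsubseteq> a" by blast
  then show "I (a \<squnion> b) \<subseteq> Y"
  proof cases
    case le
    then have "a \<squnion> b = b" using assms le_iff_meet by blast
    then show ?thesis using Y by simp
  next
    case ge
    then have "a \<squnion> b = a" using assms le_iff_meet join_comm by metis
    then show ?thesis using Y by simp
  next
    case incomparable
    then have "a \<in> I a" "b \<in> I b" "a \<noteq> b" using assms by (auto simp: I_def)
    with Y have "a \<in> Y" "b \<in> Y" "a \<noteq> b" by auto
    with Y obtain c where "c \<in> carrier L" "Y = I c" "a \<sqsubseteq> c" "b \<sqsubseteq> c"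
      by (auto simp: \<C>_def I_def)
    with assms show ?thesis by (simp add: I_mono join_le)
  qed
qed

text \<open>The greatest elements \<open>a\<close> of \<open>X\<close> and \<open>b\<close> of \<open>Y\<close> serve as witnesses for all points \<open>p\<close> at once,
  because \<open>{a, b}\<close> has the same hull as \<open>X \<union> Y\<close>.  This can fail only if \<open>a = b\<close>, where \<open>{a, b}\<close>
  is itself a member; but then one of \<open>X\<close>, \<open>Y\<close> contains the other, so \<open>p\<close> lies in \<open>X\<close> or in \<open>Y\<close> and
  is a witness for itself.\<close>

lemma point_of_hull_Un:
  assumes X: "X \<in> \<C>" "X \<noteq> {}" and Y: "Y \<in> \<C>" "Y \<noteq> {}" and p: "p \<in> hull \<C> (X \<union> Y)"
  shows "\<exists>x \<in> X. \<exists>y \<in> Y. p \<in> hull \<C> {x, y}"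
proof -
  obtain a where a: "a \<in> carrier L - {\<bottom>}" "a \<in> X" "X = {a} \<or> X = I a"
    using X by (rule mem_\<C>_cases)
  obtain b where b: "b \<in> carrier L - {\<bottom>}" "b \<in> Y" "Y = {b} \<or> Y = I b"
    using Y by (rule mem_\<C>_cases)
  show ?thesis
  proof (cases "a = b")
    case True
    then have "X \<subseteq> Y \<or> Y \<subseteq> X" using a b by auto
    then have "X \<union> Y \<in> \<C>" using X Y by (auto simp: Un_absorb1 Un_absorb2)
    then have "p \<in> X \<union> Y" using p hull_minimal[of "X \<union> Y"] by blast
    then show ?thesis
    proof
      assume "p \<in> X"
      moreover have "p \<in> hull \<C> {p, b}" using subset_hull[of "{p, b}"] by simp
      ultimately show ?thesis using b(2) by blast
    next
      assume "p \<in> Y"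
      moreover have "p \<in> hull \<C> {a, p}" using subset_hull[of "{a, p}"] by simp
      ultimately show ?thesis using a(2) by blast
    qed
  next
    case False
    have "X \<union> Y \<subseteq> Z" if "Z \<in> \<C>" "{a, b} \<subseteq> Z" for Z
      using I_subset_mem_\<C>[of Z a b] that a b False by auto
    then have "hull \<C> (X \<union> Y) \<subseteq> hull \<C> {a, b}" by (auto simp: hull_def)
    with p a b show ?thesis by blast
  qed
qed

lemma I_atom: "atom L p \<Longrightarrow> I p = {p}"
  by (auto simp: atom_def I_def)

lemma bounded_atom_embedding_I:
  assumes "inj_on code \<C>"
  shows "bounded_atom_embedding L (coded_inclusion code \<C>) (code \<circ> I)"
proof -
  interpret F: singleton_closure_family \<C> code
    by (rule singleton_closure_family_\<C>[OF assms])
  have "inj_on (code \<circ> I) (carrier L)"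
    by (rule inj_onI) (auto simp: I_mem I_subset_iff[symmetric] intro!: le_antisym)
  moreover have "join_pres L F.M (code \<circ> I)" "meet_pres L F.M (code \<circ> I)"
    using lattice_axioms F.lattice_axioms
    by (auto simp: join_pres_def meet_pres_def F.join_code F.meet_code I_mem hull_I_Un_I I_meet)
  moreover have "atom F.M (code (I p))" if "atom L p" for p
    using that by (auto simp: F.atom_M_iff I_atom Union_\<C>) (auto simp: atom_def)
  ultimately show ?thesis
    unfolding bounded_atom_embedding_def F.M_def[symmetric]
    by (auto simp: F.bottom_M F.top_M I_bottom I_top Union_\<C> I_mem)
qed

end

theorem theorem2p3:
  fixes L :: "('a, 'b) gorder_scheme"
  assumes "lattice L" and "finite (carrier L)" and "carrier L \<noteq> {}"
  shows "\<exists>(M :: nat gorder) e.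
    finite (carrier M) \<and> atomistic_lattice M \<and> biatomic_lattice M \<and>
    bounded_atom_embedding L M e"
proof -
  interpret finite_nonempty_lattice L
    using assms by (simp add: finite_nonempty_lattice_def finite_nonempty_lattice_axioms_def)
  have "finite \<C>" by (simp add: \<C>_def finite_carrier)
  then obtain code :: "'a set \<Rightarrow> nat" where code: "inj_on code \<C>"
    using finite_imp_inj_to_nat_seg by blast
  interpret F: singleton_closure_family \<C> code
    by (rule singleton_closure_family_\<C>[OF code])
  have "finite (carrier F.M)" by (simp add: F.carrier_M F.finite_family)
  moreover have "biatomic_lattice F.M"
    by (rule F.biatomic_M) (rule point_of_hull_Un)
  moreover have "bounded_atom_embedding L F.M (code \<circ> I)"
    unfolding F.M_def by (rule bounded_atom_embedding_I[OF code])
  ultimately show ?thesis using F.atomistic_M by blast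
qed

end
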